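(* Assume that the problem has no integer variables, i.e. $n_i=0$, and that $h^L(\boldsymbol{\rho}^*_{\lambda_1},\lambda_2)$ and $h^L(\boldsymbol{\rho}^*_{\lambda_2},\lambda_1)$ are finite. Then, for every $\lambda\in[\lambda_1,\lambda_2]$, $$f(\lambda)\ge\max\left\{\ell[(\lambda_1,\lambda_2),(f(\lambda_1),h^L(\boldsymbol{\rho}^*_{\lambda_1},\lambda_2))](\lambda),\ \ell[(\lambda_1,\lambda_2),(f(\lambda_2),h^L(\boldsymbol{\rho}^*_{\lambda_2},\lambda_1))](\lambda)\right\}.$$
   Context: Let $\mathbf{c}\in\mathbb{R}^n$, $A_1\in\mathbb{R}^{m_1\times n}$, $A_2,D\in\mathbb{R}^{m_2\times n}$, $\mathbf{b}_1\in\mathbb{R}^{m_1}$, $\mathbf{b}_2\in\mathbb{R}^{m_2}$, and real numbers $\lambda_1<\lambda_2$. Since $n_i=0$, $\mathcal{P}(\lambda)$ is the linear program $\min\ \mathbf{c}^t\mathbf{x}$ s.t. $A_1\mathbf{x}\le\mathbf{b}_1$, $(A_2+\lambda D)\mathbf{x}\le\mathbf{b}_2$, $\mathbf{x}\in\mathbb{R}^n$; $f(\lambda)$ is its optimal value (infimum, in $\mathbb{R}\cup\{\pm\infty\}$, $+\infty$ if infeasible). It is assumed that $\mathcal{P}(\lambda_1)$ and $\mathcal{P}(\lambda_2)$ have optimal solutions. The dual of $\mathcal{P}(\lambda)$ is $\max\ \mathbf{b}_1^t\boldsymbol{\sigma}+\mathbf{b}_2^t\boldsymbol{\rho}$ s.t.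 $A_1^t\boldsymbol{\sigma}+(A_2+\lambda D)^t\boldsymbol{\rho}=\mathbf{c}$, $\boldsymbol{\sigma}\le\mathbf{0}$, $\boldsymbol{\rho}\le\mathbf{0}$; $\boldsymbol{\rho}^*_{\lambda_k}$ ($k=1,2$) denotes the $\boldsymbol{\rho}$-part of an optimal solution of the dual of $\mathcal{P}(\lambda_k)$. For $\boldsymbol{\rho}\in\mathbb{R}^{m_2}$, $\boldsymbol{\rho}\le\mathbf{0}$, $h^L(\boldsymbol{\rho},\lambda)$ is the optimal value of the Lagrangian relaxation $$\min\ \mathbf{c}^t\mathbf{x}-\boldsymbol{\rho}^t((A_2+\lambda D)\mathbf{x}-\mathbf{b}_2)\ \text{ s.t. } A_1\mathbf{x}\le\mathbf{b}_1,\ \mathbf{x}\in\mathbb{R}^n.$$ For real numbers $x_1\neq x_2$ and $y_1,y_2$, the linear interpolation is $\ell[(x_1,x_2),(y_1,y_2)](t)=y_1+(t-x_1)\frac{y_2-y_1}{x_2-x_1}$.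
   Formalization: The second interpolation is taken with nodes (λ2,λ1) instead of (λ1,λ2), so that f(λ2) is the value at λ2 and h^L(ρ*_{λ2},λ1) the value at λ1; as printed, the bound would give f(λ1) ≥ f(λ2), which fails in general. *)

theory Defs
  imports "HOL-Analysis.Analysis"
begin

(* The order on real ^ 'n is the componentwise one. *)

definition lp_feasible ::
  "real^'n^'m1 \<Rightarrow> real^'n^'m2 \<Rightarrow> real^'n^'m2 \<Rightarrow> real^'m1 \<Rightarrow> real^'m2 \<Rightarrow> real \<Rightarrow> (real^'n) set" where
  "lp_feasible A1 A2 D b1 b2 l = {x. A1 *v x \<le> b1 \<and> (A2 + l *\<^sub>R D) *v x \<le> b2}"

(* Inf {} = \<infinity> in ereal, so an infeasible program has value \<infinity>. *)
definition lp_value ::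
  "real^'n \<Rightarrow> real^'n^'m1 \<Rightarrow> real^'n^'m2 \<Rightarrow> real^'n^'m2 \<Rightarrow> real^'m1 \<Rightarrow> real^'m2 \<Rightarrow> real \<Rightarrow> ereal" where
  "lp_value c A1 A2 D b1 b2 l = (INF x\<in>lp_feasible A1 A2 D b1 b2 l. ereal (c \<bullet> x))"

definition lp_optimal ::
  "real^'n \<Rightarrow> real^'n^'m1 \<Rightarrow> real^'n^'m2 \<Rightarrow> real^'n^'m2 \<Rightarrow> real^'m1 \<Rightarrow> real^'m2 \<Rightarrow> real \<Rightarrow> real^'n \<Rightarrow> bool" where
  "lp_optimal c A1 A2 D b1 b2 l x \<longleftrightarrow>
     x \<in> lp_feasible A1 A2 D b1 b2 l \<and> (\<forall>y\<in>lp_feasible A1 A2 D b1 b2 l. c \<bullet> x \<le> c \<bullet> y)"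

(* Both dual variables are nonpositive: multipliers of "\<le>" constraints in a minimisation. *)
definition dual_feasible ::
  "real^'n \<Rightarrow> real^'n^'m1 \<Rightarrow> real^'n^'m2 \<Rightarrow> real^'n^'m2 \<Rightarrow> real \<Rightarrow> ((real^'m1) \<times> (real^'m2)) set" where
  "dual_feasible c A1 A2 D l =
     {(\<sigma>, \<rho>). transpose A1 *v \<sigma> + transpose (A2 + l *\<^sub>R D) *v \<rho> = c \<and> \<sigma> \<le> 0 \<and> \<rho> \<le> 0}"

definition dual_optimal ::
  "real^'n \<Rightarrow> real^'n^'m1 \<Rightarrow> real^'n^'m2 \<Rightarrow> real^'n^'m2 \<Rightarrow> real^'m1 \<Rightarrow> real^'m2 \<Rightarrow> real \<Rightarrow>
     real^'m1 \<Rightarrow> real^'m2 \<Rightarrow> bool" where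
  "dual_optimal c A1 A2 D b1 b2 l \<sigma> \<rho> \<longleftrightarrow>
     (\<sigma>, \<rho>) \<in> dual_feasible c A1 A2 D l \<and>
     (\<forall>(\<sigma>', \<rho>')\<in>dual_feasible c A1 A2 D l. b1 \<bullet> \<sigma>' + b2 \<bullet> \<rho>' \<le> b1 \<bullet> \<sigma> + b2 \<bullet> \<rho>)"

(* Only the constraints depending on l are relaxed. *)
definition lagrangian_value ::
  "real^'n \<Rightarrow> real^'n^'m1 \<Rightarrow> real^'n^'m2 \<Rightarrow> real^'n^'m2 \<Rightarrow> real^'m1 \<Rightarrow> real^'m2 \<Rightarrow>
     real^'m2 \<Rightarrow> real \<Rightarrow> ereal" where
  "lagrangian_value c A1 A2 D b1 b2 \<rho> l =
     (INF x\<in>{x. A1 *v x \<le> b1}. ereal (c \<bullet> x - \<rho> \<bullet> ((A2 + l *\<^sub>R D) *v x - b2)))"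

(* For x1 \<noteq> x2, the line through (x1, y1) and (x2, y2). *)
definition lin_interp :: "real \<times> real \<Rightarrow> real \<times> real \<Rightarrow> real \<Rightarrow> real" where
  "lin_interp = (\<lambda>(x1, x2) (y1, y2) t. y1 + (t - x1) * ((y2 - y1) / (x2 - x1)))"

end

theory Submission
  imports Defs
begin

(* The Lagrangian cx - \<rho>((A2 + l D)x - b2) is affine in l for fixed x and bounded below by
   its infimum at each endpoint, so any convex combination of these two infima bounds it from
   below in between; on feasible x it is at most cx because \<rho> \<le> 0. For \<rho> optimal in the
   dual at an endpoint, LP strong duality puts the infimum at that endpoint above f. *)

text \<open>The cone generated by finitely many vectors is closed and convex, so a \<open>c\<close>
  outside it could be separated from it by a hyperplane, whose normal would contradict
  \<open>nonneg\<close>.\<close>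

lemma farkas:
  fixes a :: "'i \<Rightarrow> 'v::euclidean_space"
  assumes "finite I" and nonneg: "\<And>d. (\<forall>i\<in>I. 0 \<le> a i \<bullet> d) \<Longrightarrow> 0 \<le> c \<bullet> d"
  shows "\<exists>u. (\<forall>i\<in>I. 0 \<le> u i) \<and> c = (\<Sum>i\<in>I. u i *\<^sub>R a i)"
proof -
  define K where "K = convex_cone hull (a ` I)"
  define S where "S = {x. \<exists>u. (\<forall>i\<in>I. 0 \<le> u i) \<and> x = (\<Sum>i\<in>I. u i *\<^sub>R a i)}"
  have scale: "t *\<^sub>R x \<in> K" if "x \<in> K" "0 \<le> t" for t x
    using that convex_cone_hull_mul unfolding K_def by blast
  have "c \<in> K"
  proof (rule ccontr)
    assume "c \<notin> K"
    moreover have "convex K" "closed K"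
      using assms(1) by (auto simp: K_def convex_convex_cone_hull closed_convex_cone_hull)
    ultimately obtain d e where d: "d \<bullet> c < e" "\<And>x. x \<in> K \<Longrightarrow> e < d \<bullet> x"
      using separating_hyperplane_closed_point by metis
    have "e < 0"
      using d(2)[of 0] by (simp add: K_def convex_cone_hull_contains_0)
    have "0 \<le> a i \<bullet> d" if "i \<in> I" for i
    proof (rule ccontr)
      assume neg: "\<not> 0 \<le> a i \<bullet> d"
      have "a i \<in> K"
        unfolding K_def using that by (auto intro: hull_inc)
      \<comment> \<open>The multiple is scaled so that its inner product with \<open>d\<close> is
        exactly \<open>e\<close>; both \<open>e\<close> and \<open>a i \<bullet> d\<close> are
        negative, so the factor is nonnegative and the point stays in the cone.\<close>
      then have "e < d \<bullet> ((e / (a i \<bullet> d)) *\<^sub>R a i)"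
        using neg \<open>e < 0\<close> by (intro d(2) scale) (auto intro: divide_nonpos_neg)
      then show False
        using neg by (simp add: inner_commute)
    qed
    then have "0 \<le> c \<bullet> d"
      by (intro nonneg) auto
    then show False
      using d(1) \<open>e < 0\<close> by (simp add: inner_commute)
  qed
  \<comment> \<open>The hull is the smallest convex cone containing the generators, so it suffices
    that the nonnegative combinations form such a cone.\<close>
  moreover have "K \<subseteq> S"
    unfolding K_def
  proof (rule hull_minimal)
    show "a ` I \<subseteq> S"
    proof
      fix x assume "x \<in> a ` I"
      then obtain j where j: "j \<in> I" "x = a j" by auto
      have "(\<Sum>i\<in>I. (if i = j then 1 else 0) *\<^sub>R a i) = (\<Sum>i\<in>I. if i = j then a i else 0)"
        by (rule sum.cong) auto
      also have "\<dots> = x"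
        using j assms(1) by simp
      finally have "x = (\<Sum>i\<in>I. (if i = j then 1 else 0) *\<^sub>R a i)" ..
      then show "x \<in> S"
        unfolding S_def by (intro CollectI exI[of _ "\<lambda>i. if i = j then 1 else 0"]) auto
    qed
    have "0 \<in> S"
      unfolding S_def by (intro CollectI exI[of _ "\<lambda>_. 0"]) auto
    moreover have "x + y \<in> S" if x: "x \<in> S" and y: "y \<in> S" for x y
    proof -
      obtain u where "\<forall>i\<in>I. 0 \<le> u i" "x = (\<Sum>i\<in>I. u i *\<^sub>R a i)"
        using x unfolding S_def by auto
      moreover obtain v where "\<forall>i\<in>I. 0 \<le> v i" "y = (\<Sum>i\<in>I. v i *\<^sub>R a i)"
        using y unfolding S_def by auto
      ultimately show ?thesis
        unfolding S_def by (intro CollectI exI[of _ "\<lambda>i. u i + v i"])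
          (auto simp: scaleR_add_left sum.distrib)
    qed
    moreover have "t *\<^sub>R x \<in> S" if x: "x \<in> S" and "0 \<le> t" for t x
    proof -
      obtain u where "\<forall>i\<in>I. 0 \<le> u i" "x = (\<Sum>i\<in>I. u i *\<^sub>R a i)"
        using x unfolding S_def by auto
      then show ?thesis
        using \<open>0 \<le> t\<close> unfolding S_def by (intro CollectI exI[of _ "\<lambda>i. t * u i"])
          (auto simp: scaleR_sum_right)
    qed
    ultimately show "convex_cone S"
      by (auto simp: convex_cone_iff)
  qed
  ultimately show ?thesis
    unfolding S_def by auto
qed

text \<open>Optimality forbids a direction that keeps the active constraints and decreases the
  objective, so Farkas writes \<open>c\<close> through the active rows alone. Complementary
  slackness then gives equal values.\<close>

lemma linear_program_multipliers:
  fixes a :: "'i \<Rightarrow> 'v::euclidean_space"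
  assumes "finite I" and feasible: "\<And>i. i \<in> I \<Longrightarrow> a i \<bullet> x \<le> b i"
    and optimal: "\<And>y. (\<forall>i\<in>I. a i \<bullet> y \<le> b i) \<Longrightarrow> c \<bullet> x \<le> c \<bullet> y"
  shows "\<exists>u. (\<forall>i\<in>I. u i \<le> 0) \<and> c = (\<Sum>i\<in>I. u i *\<^sub>R a i) \<and> (\<Sum>i\<in>I. u i * b i) = c \<bullet> x"
proof -
  define J where "J = {i\<in>I. a i \<bullet> x = b i}"
  have "J \<subseteq> I" "finite J"
    using assms(1) by (auto simp: J_def)
  \<comment> \<open>A direction that keeps the active constraints keeps the others for small steps.\<close>
  have "0 \<le> c \<bullet> d" if d: "\<forall>i\<in>J. 0 \<le> - a i \<bullet> d" for d
  proof -
    have "\<forall>\<^sub>F t in at_right (0::real). a i \<bullet> (x + t *\<^sub>R d) \<le> b i" if "i \<in> I" for i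
    proof (cases "i \<in> J")
      case True
      have "\<forall>\<^sub>F t in at_right (0::real). 0 < t"
        by (simp add: eventually_at_right_less)
      then show ?thesis
        using True d
        by (auto elim!: eventually_mono simp: J_def inner_add_right mult_nonneg_nonpos)
    next
      case False
      then have "a i \<bullet> x < b i"
        using feasible[OF that] that by (auto simp: J_def)
      moreover have "((\<lambda>t. a i \<bullet> (x + t *\<^sub>R d)) \<longlongrightarrow> a i \<bullet> (x + 0 *\<^sub>R d)) (at_right 0)"
        by (intro tendsto_intros)
      ultimately have "\<forall>\<^sub>F t in at_right 0. a i \<bullet> (x + t *\<^sub>R d) < b i"
        by (intro order_tendstoD) auto
      then show ?thesis
        by (rule eventually_mono) simp
    qed
    \<comment> \<open>Finitely many constraints admit a common step size \<open>t\<close>;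
      optimality against \<open>x + t *\<^sub>R d\<close> then gives 0 \<le>
      \<open>t * (c \<bullet> d)\<close>.\<close>
    then have "\<forall>\<^sub>F t in at_right (0::real). (\<forall>i\<in>I. a i \<bullet> (x + t *\<^sub>R d) \<le> b i) \<and> 0 < t"
      using assms(1)
      by (intro eventually_conj eventually_ball_finite) (auto simp: eventually_at_right_less)
    then obtain t :: real where "\<forall>i\<in>I. a i \<bullet> (x + t *\<^sub>R d) \<le> b i" "0 < t"
      using eventually_happens[of _ "at_right (0::real)"] trivial_limit_at_right_real by blast
    then show ?thesis
      using optimal[of "x + t *\<^sub>R d"] by (simp add: inner_add_right zero_le_mult_iff)
  qed
  then obtain v where v: "\<forall>i\<in>J. 0 \<le> v i" "c = (\<Sum>i\<in>J. v i *\<^sub>R - a i)"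
    using farkas[OF \<open>finite J\<close>, of "\<lambda>i. - a i" c] by blast
  \<comment> \<open>The sign flips because Farkas was applied to the negated rows; inactive
    constraints get multiplier zero.\<close>
  define u where "u = (\<lambda>i. if i \<in> J then - v i else 0)"
  have restrict: "(\<Sum>i\<in>I. u i *\<^sub>R a i) = (\<Sum>i\<in>J. u i *\<^sub>R a i)"
    "(\<Sum>i\<in>I. u i * b i) = (\<Sum>i\<in>J. u i * b i)"
    using assms(1) \<open>J \<subseteq> I\<close> by (intro sum.mono_neutral_right; auto simp: u_def)+
  have c: "c = (\<Sum>i\<in>J. u i *\<^sub>R a i)"
    unfolding v(2) by (rule sum.cong) (auto simp: u_def)
  \<comment> \<open>On \<open>J\<close> each \<open>b i\<close> equals
    \<open>a i \<bullet> x\<close>, so the sum is the expansion of \<open>c\<close> paired with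
    \<open>x\<close>.\<close>
  then have "(\<Sum>i\<in>J. u i * b i) = c \<bullet> x"
    by (auto simp: inner_sum_left J_def intro!: sum.cong)
  moreover have "\<forall>i\<in>I. u i \<le> 0"
    using v(1) by (auto simp: u_def)
  ultimately show ?thesis
    using restrict c by auto
qed

lemma transpose_mult_vec_eq_sum:
  "transpose A *v u = (\<Sum>i\<in>UNIV. u $ i *\<^sub>R A $ i)" for A :: "real^'n^'m"
  by (simp add: vec_eq_iff matrix_vector_mult_def transpose_def mult.commute)

lemma inner_transpose_mult_vec:
  "(transpose A *v u) \<bullet> x = u \<bullet> (A *v x)" for A :: "real^'n^'m"
  by (simp add: transpose_matrix_vector dot_lmul_matrix)

lemma inner_mono_nonpos:
  "u \<bullet> y \<le> u \<bullet> x" if "u \<le> 0" "x \<le> y" for u x y :: "real^'m"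
  using that by (auto simp: inner_vec_def less_eq_vec_def intro!: sum_mono mult_left_mono_neg)

text \<open>The multipliers at \<open>x\<close> form a dual feasible pair of value
  \<open>c \<bullet> x\<close>, which the optimal pair cannot undercut.\<close>

lemma strong_duality:
  assumes "lp_optimal c A1 A2 D b1 b2 l x" "dual_optimal c A1 A2 D b1 b2 l \<sigma> \<rho>"
  shows "c \<bullet> x \<le> b1 \<bullet> \<sigma> + b2 \<bullet> \<rho>"
proof -
  define M where "M = A2 + l *\<^sub>R D"
  \<comment> \<open>Both blocks of constraints become one family indexed by a sum type; its
    multipliers split back into \<open>s\<close> and \<open>r\<close>.\<close>
  define a where "a = case_sum (\<lambda>i. A1 $ i) (\<lambda>j. M $ j)"
  define b where "b = case_sum (\<lambda>i. b1 $ i) (\<lambda>j. b2 $ j)"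
  have feasible: "y \<in> lp_feasible A1 A2 D b1 b2 l \<longleftrightarrow> (\<forall>i. a i \<bullet> y \<le> b i)" for y
    by (auto simp: lp_feasible_def less_eq_vec_def matrix_vector_mul_component a_def b_def M_def
        split: sum.splits)
  obtain u where u: "\<And>i. u i \<le> 0" "c = (\<Sum>i\<in>UNIV. u i *\<^sub>R a i)" "(\<Sum>i\<in>UNIV. u i * b i) = c \<bullet> x"
    using linear_program_multipliers[of UNIV a x b c] assms(1)
    by (auto simp: lp_optimal_def feasible)
  define s where "s = (\<chi> i. u (Inl i))"
  define r where "r = (\<chi> j. u (Inr j))"
  have "(s, r) \<in> dual_feasible c A1 A2 D l"
    using u(1) unfolding dual_feasible_def M_def[symmetric] u(2)
    by (auto simp: transpose_mult_vec_eq_sum UNIV_Plus_UNIV[symmetric] sum.Plus a_def s_def r_def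
        less_eq_vec_def simp del: UNIV_Plus_UNIV transpose_matrix_vector)
  then have "b1 \<bullet> s + b2 \<bullet> r \<le> b1 \<bullet> \<sigma> + b2 \<bullet> \<rho>"
    using assms(2) by (auto simp: dual_optimal_def)
  moreover have "b1 \<bullet> s + b2 \<bullet> r = c \<bullet> x"
    unfolding u(3)[symmetric]
    by (simp add: UNIV_Plus_UNIV[symmetric] sum.Plus b_def s_def r_def inner_vec_def mult.commute
        del: UNIV_Plus_UNIV)
  ultimately show ?thesis by simp
qed

text \<open>The dual equation cancels the \<rho> terms in \<open>x\<close>: the Lagrangian becomes
  \<open>\<sigma> \<bullet> (A1 *v x) + \<rho> \<bullet> b2\<close>, and \<sigma> \<le> 0 bounds its
  first term from below.\<close>

lemma dual_value_le_lagrangian: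
  assumes "(\<sigma>, \<rho>) \<in> dual_feasible c A1 A2 D l" "A1 *v x \<le> b1"
  shows "b1 \<bullet> \<sigma> + b2 \<bullet> \<rho> \<le> c \<bullet> x - \<rho> \<bullet> ((A2 + l *\<^sub>R D) *v x - b2)"
proof -
  have "c \<bullet> x = \<sigma> \<bullet> (A1 *v x) + \<rho> \<bullet> ((A2 + l *\<^sub>R D) *v x)"
    using assms(1)
    by (auto simp: dual_feasible_def inner_add_left[symmetric] inner_transpose_mult_vec[symmetric])
  moreover have "\<sigma> \<bullet> b1 \<le> \<sigma> \<bullet> (A1 *v x)"
    using assms by (auto simp: dual_feasible_def intro: inner_mono_nonpos)
  ultimately show ?thesis
    by (simp add: inner_diff_right inner_commute)
qed

text \<open>An attained infimum is finite, so \<open>real_of_ereal\<close> does not fall back to its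
  default at the endpoints of the interpolation.\<close>

lemma lp_value_eq:
  assumes "lp_optimal c A1 A2 D b1 b2 l x"
  shows "lp_value c A1 A2 D b1 b2 l = ereal (c \<bullet> x)"
  unfolding lp_value_def using assms
  by (intro antisym INF_lower INF_greatest) (auto simp: lp_optimal_def)

lemma lin_interp_convex_combination:
  assumes "x1 \<noteq> x2"
  shows "lin_interp (x1, x2) (y1, y2) ((1 - t) * x1 + t * x2) = (1 - t) * y1 + t * y2"
proof -
  have "(1 - t) * x1 + t * x2 - x1 = t * (x2 - x1)"
    by (simp add: algebra_simps)
  then show ?thesis
    using assms by (simp add: lin_interp_def) (simp add: algebra_simps)
qed

text \<open>The endpoints are unordered, so that both lines of the theorem are instances with the
  roles of the endpoints exchanged.\<close>

lemma lin_interp_le_lp_value: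
  assumes "k1 \<noteq> k2" "l \<in> closed_segment k1 k2"
    and x: "lp_optimal c A1 A2 D b1 b2 k1 x" and dual: "dual_optimal c A1 A2 D b1 b2 k1 \<sigma> \<rho>"
    and finite: "\<bar>lagrangian_value c A1 A2 D b1 b2 \<rho> k2\<bar> \<noteq> \<infinity>"
  shows "ereal (lin_interp (k1, k2) (real_of_ereal (lp_value c A1 A2 D b1 b2 k1),
    real_of_ereal (lagrangian_value c A1 A2 D b1 b2 \<rho> k2)) l) \<le> lp_value c A1 A2 D b1 b2 l"
proof -
  obtain t where t: "0 \<le> t" "t \<le> 1" "l = (1 - t) * k1 + t * k2"
    using assms(2) by (auto simp: in_segment)
  define L where "L = (\<lambda>k y. c \<bullet> y - \<rho> \<bullet> ((A2 + k *\<^sub>R D) *v y - b2))"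
  obtain h where h: "lagrangian_value c A1 A2 D b1 b2 \<rho> k2 = ereal h"
    using finite by (cases "lagrangian_value c A1 A2 D b1 b2 \<rho> k2") auto
  have dual_feasible: "(\<sigma>, \<rho>) \<in> dual_feasible c A1 A2 D k1"
    using dual by (simp add: dual_optimal_def)
  then have "\<rho> \<le> 0"
    by (simp add: dual_feasible_def)
  have "(1 - t) * (c \<bullet> x) + t * h \<le> c \<bullet> y" if "y \<in> lp_feasible A1 A2 D b1 b2 l" for y
  proof -
    have y: "A1 *v y \<le> b1" "(A2 + l *\<^sub>R D) *v y \<le> b2"
      using that by (auto simp: lp_feasible_def)
    have "c \<bullet> x \<le> L k1 y"
      using strong_duality[OF x dual] dual_value_le_lagrangian[OF dual_feasible y(1), of b2]
      by (simp add: L_def)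
    moreover have "ereal h \<le> ereal (L k2 y)"
      unfolding h[symmetric] lagrangian_value_def L_def using y(1) by (intro INF_lower) auto
    ultimately have "(1 - t) * (c \<bullet> x) + t * h \<le> (1 - t) * L k1 y + t * L k2 y"
      using t by (intro add_mono mult_left_mono) auto
    \<comment> \<open>\<open>L\<close> is affine in its first argument and the weights sum to
      1.\<close>
    also have "\<dots> = L l y"
      by (simp add: L_def t(3) matrix_vector_mult_add_rdistrib scaleR_matrix_vector_assoc[symmetric]
          inner_diff_right inner_add_right algebra_simps)
    \<comment> \<open>Feasibility at \<open>l\<close> and \<rho> \<le> 0 make the subtracted penalty
      nonnegative.\<close>
    also have "\<dots> \<le> c \<bullet> y"
      using inner_mono_nonpos[OF \<open>\<rho> \<le> 0\<close> y(2)] by (simp add: L_def inner_diff_right)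
    finally show ?thesis .
  qed
  then have "ereal ((1 - t) * (c \<bullet> x) + t * h) \<le> lp_value c A1 A2 D b1 b2 l"
    unfolding lp_value_def by (intro INF_greatest) simp
  then show ?thesis
    using lin_interp_convex_combination[OF assms(1)] by (simp add: t(3) h lp_value_eq[OF x])
qed

theorem theorem8:
  fixes c :: "real^'n" and A1 :: "real^'n^'m1" and A2 D :: "real^'n^'m2"
    and b1 :: "real^'m1" and b2 :: "real^'m2"
    and l1 l2 l :: real
    and \<sigma>1 \<sigma>2 :: "real^'m1" and \<rho>1 \<rho>2 :: "real^'m2"
  defines "f \<equiv> lp_value c A1 A2 D b1 b2"
    and "hL \<equiv> lagrangian_value c A1 A2 D b1 b2"
  assumes "l1 < l2"
    and "\<exists>x. lp_optimal c A1 A2 D b1 b2 l1 x"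
    and "\<exists>x. lp_optimal c A1 A2 D b1 b2 l2 x"
    and "dual_optimal c A1 A2 D b1 b2 l1 \<sigma>1 \<rho>1"
    and "dual_optimal c A1 A2 D b1 b2 l2 \<sigma>2 \<rho>2"
    and "\<bar>hL \<rho>1 l2\<bar> \<noteq> \<infinity>"
    and "\<bar>hL \<rho>2 l1\<bar> \<noteq> \<infinity>"
    and "l \<in> {l1..l2}"
  shows "f l \<ge> ereal (max
    (lin_interp (l1, l2) (real_of_ereal (f l1), real_of_ereal (hL \<rho>1 l2)) l)
    (lin_interp (l2, l1) (real_of_ereal (f l2), real_of_ereal (hL \<rho>2 l1)) l))"
proof -
  \<comment> \<open>The reversed segment serves the second line, whose strong duality endpoint is
    \<open>l2\<close>.\<close>
  have "l \<in> closed_segment l1 l2" "l \<in> closed_segment l2 l1"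
    using assms(3,10) by (auto simp: closed_segment_eq_real_ivl)
  then show ?thesis
    using lin_interp_le_lp_value[of l1 l2 l c A1 A2 D b1 b2 _ \<sigma>1 \<rho>1]
      lin_interp_le_lp_value[of l2 l1 l c A1 A2 D b1 b2 _ \<sigma>2 \<rho>2] assms
    by (auto simp: max_def)
qed

end
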